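(* The exponential generating function $R_2(z)=\sum_{n\ge0}r_{2,n}\frac{z^n}{n!}$ of relaxed trees of right height at most $2$ is D-finite and satisfies $$ (z^2-3z+1)R_2''(z)+(2z-3)R_2'(z)=0,\qquad R_2(0)=1,\ R_2'(0)=1. $$ A closed form is $$ R_2(z)=-\frac{2}{\sqrt5}\operatorname{artanh}\!\left(\frac{2z-3}{\sqrt5}\right)-\frac{1}{\sqrt5}\left(\log\!\left(\frac{7+3\sqrt5}{2}\right)-\pi i\right), $$ and for $n\ge1$ $$ r_{2,n}=\frac{(n-1)!}{\sqrt5}\left(\left(\frac{3+\sqrt5}{2}\right)^n-\left(\frac{3-\sqrt5}{2}\right)^n\right). $$
   Context: A relaxed tree of size $n$: take a full binary tree $T$ (each node $0$ or $2$ ordered children) with $n$ internal nodes, traverse in post-order (left, right, node); keep the first leaf as the sink and replace every other leaf $\lambda$ by a pointer to a node (internal node or sink) visited before $\lambda$; relaxed trees are equal iff same $T$ and same targets. The spine is the binary tree of internal nodes of $T$ with the tree edges between them; the right height is the maximal number of right edges on a spine path from the root. $r_{2,n}$ counts relaxed trees of size $n$ with right height at most $2$.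
   Formalization: The printed closed form gives 0 at z=0, contradicting R_2(0)=1, so the summand 1 is added to it; artanh is read, on |z|<(3-√5)/2, as the holomorphic inverse of tanh agreeing with the principal value for Im z≥0. *)

theory Defs
  imports "HOL-Complex_Analysis.Complex_Analysis"
begin

datatype full_tree = Leaf | Node full_tree full_tree

text \<open>
  A node of a tree is addressed by the path leading to it from the root:
  \<open>False\<close> is a step to the left child, \<open>True\<close> a step to the right child.
\<close>

type_synonym pos = "bool list"

fun postorder :: "full_tree \<Rightarrow> pos list" where
  "postorder Leaf = [[]]"
| "postorder (Node l r) = map (Cons False) (postorder l) @ map (Cons True) (postorder r) @ [[]]"

fun leaves :: "full_tree \<Rightarrow> pos set" where
  "leaves Leaf = {[]}"
| "leaves (Node l r) = Cons False ` leaves l \<union> Cons True ` leaves r"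

fun internal_nodes :: "full_tree \<Rightarrow> pos set" where
  "internal_nodes Leaf = {}"
| "internal_nodes (Node l r) =
     insert [] (Cons False ` internal_nodes l \<union> Cons True ` internal_nodes r)"

definition visited_before :: "full_tree \<Rightarrow> pos \<Rightarrow> pos \<Rightarrow> bool" where
  "visited_before T u v \<longleftrightarrow>
     (\<exists>i j. i < j \<and> j < length (postorder T) \<and> postorder T ! i = u \<and> postorder T ! j = v)"

definition sink :: "full_tree \<Rightarrow> pos" where
  "sink T = hd (filter (\<lambda>v. v \<in> leaves T) (postorder T))"

text \<open>
  A relaxed tree is a pair of a full binary tree and the partial map sending each leaf other than
  the sink to the target of its pointer. The map is undefined everywhere else, so that equality
  of pairs is equality of relaxed trees.
\<close>

type_synonym relaxed_tree = "full_tree \<times> (pos \<rightharpoonup> pos)"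

definition is_relaxed_tree :: "relaxed_tree \<Rightarrow> bool" where
  "is_relaxed_tree = (\<lambda>(T, p).
     dom p = leaves T - {sink T} \<and>
     (\<forall>v u. p v = Some u \<longrightarrow> u \<in> insert (sink T) (internal_nodes T) \<and> visited_before T u v))"

text \<open>
  The vertices of the spine are the internal nodes. All nodes on the tree path from the root to
  an internal node are internal, so the spine path to \<open>v\<close> is the word \<open>v\<close> and its right edges are
  the occurrences of \<open>True\<close>. The inserted \<open>0\<close> matters for the empty spine only.
\<close>

definition right_height :: "full_tree \<Rightarrow> nat" where
  "right_height T = Max (insert 0 ((\<lambda>v. count_list v True) ` internal_nodes T))"

definition relaxed_trees :: "nat \<Rightarrow> nat \<Rightarrow> relaxed_tree set" where
  "relaxed_trees k n =
     {(T, p). is_relaxed_tree (T, p) \<and> card (internal_nodes T) = n \<and> right_height T \<le> k}"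

definition relaxed_count :: "nat \<Rightarrow> nat \<Rightarrow> nat" where
  "relaxed_count k n = card (relaxed_trees k n)"

definition relaxed_egf :: "nat \<Rightarrow> complex fps" where
  "relaxed_egf k = Abs_fps (\<lambda>n. of_nat (relaxed_count k n) / fact n)"

definition D_finite :: "'a::field fps \<Rightarrow> bool" where
  "D_finite F \<longleftrightarrow>
     (\<exists>(m::nat) (a :: nat \<Rightarrow> 'a poly). a m \<noteq> 0 \<and>
        (\<Sum>i\<le>m. fps_of_poly (a i) * (fps_deriv ^^ i) F) = 0)"

text \<open>
  The branch of \<open>artanh\<close> in the closed form: \<open>z \<mapsto> (2 * z - 3) / sqrt 5\<close> maps the real points of
  the disc of convergence, of radius \<open>(3 - sqrt 5) / 2\<close>, into the cut of the principal \<open>artanh\<close>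
  along the reals below \<open>-1\<close>. There the library's value has imaginary part \<open>pi / 2\<close>, which is
  the one cancelled by the summand \<open>- pi * \<i>\<close>, and it is continuous from above only. The
  composite is therefore described as the holomorphic function on the disc that inverts \<open>tanh\<close>
  and agrees with the principal value on the closed upper half of the disc.

  The constant of the closed form: the terms with \<open>artanh\<close>, \<open>ln\<close> and \<open>pi\<close> sum up to \<open>0\<close> at
  \<open>z = 0\<close>, and other branches change this by purely imaginary amounts only. As the series has
  constant coefficient \<open>1\<close>, the closed form carries the summand \<open>1\<close>.
\<close>

end

theory Submission
  imports Defs
begin

text \<open>
  If \<open>m\<close> targets are available before a subtree is visited, then the number of pointer
  assignments in it is \<open>m\<close> for a leaf, and for a node the product of the number for the left
  subtree with \<open>m\<close> and the number for the right subtree with \<open>m + |l|\<close>. With \<open>m = 1\<close>, the first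
  leaf contributes the factor \<open>1\<close>, so that it need not be treated specially. Summing over the trees of
  size \<open>n\<close> and right height at most \<open>k\<close> gives
  \<open>S\<^sub>k(n+1, m) = (\<Sum>i\<le>n. S\<^sub>k(i, m) S\<^sub>k\<^sub>-\<^sub>1(n-i, m+i))\<close>. If \<open>S\<^sub>k\<^sub>-\<^sub>1\<close> satisfies a recurrence in \<open>n\<close> whose
  coefficients depend on \<open>n + m\<close> only, this convolution can be telescoped to one for \<open>S\<^sub>k\<close>; for
  \<open>k = 2\<close>, \<open>m = 1\<close> the result is \<open>r\<^sub>n\<^sub>+\<^sub>2 = 3(n+1) r\<^sub>n\<^sub>+\<^sub>1 - n(n+1) r\<^sub>n\<close>.
\<close>

subsection \<open>Pointer assignments as tree weights\<close>

text \<open>List version of \<open>visited_before\<close>: for lists, precedence can be computed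
  along \<open>@\<close> and \<open>map\<close>, from which \<open>postorder\<close> is
  built.\<close>

definition before :: "'a list \<Rightarrow> 'a \<Rightarrow> 'a \<Rightarrow> bool" where
  "before xs u v \<longleftrightarrow> (\<exists>i j. i < j \<and> j < length xs \<and> xs ! i = u \<and> xs ! j = v)"

lemma visited_before_eq_before: "visited_before T = before (postorder T)"
  by (intro ext) (simp add: visited_before_def before_def)

lemma before_Nil [simp]: "\<not> before [] u v"
  by (simp add: before_def)

lemma before_Cons: "before (x # xs) u v \<longleftrightarrow> u = x \<and> v \<in> set xs \<or> before xs u v"
proof
  assume "before (x # xs) u v"
  then obtain i j where ij: "i < j" "j < length (x # xs)" "(x # xs) ! i = u" "(x # xs) ! j = v"
    unfolding before_def by blast
  then obtain j' where j: "j = Suc j'" by (cases j) auto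
  show "u = x \<and> v \<in> set xs \<or> before xs u v"
  proof (cases i)
    case 0
    with ij j show ?thesis by auto
  next
    case (Suc i')
    with ij j show ?thesis unfolding before_def by auto
  qed
next
  assume "u = x \<and> v \<in> set xs \<or> before xs u v"
  then show "before (x # xs) u v"
  proof
    assume "u = x \<and> v \<in> set xs"
    then obtain j where "j < length xs" "xs ! j = v" "u = x" by (auto simp: in_set_conv_nth)
    then show ?thesis unfolding before_def by (intro exI[of _ 0] exI[of _ "Suc j"]) auto
  next
    assume "before xs u v"
    then obtain i j where "i < j" "j < length xs" "xs ! i = u" "xs ! j = v"
      unfolding before_def by blast
    then show ?thesis unfolding before_def by (intro exI[of _ "Suc i"] exI[of _ "Suc j"]) auto
  qed
qed

lemma before_append:
  "before (xs @ ys) u v \<longleftrightarrow> before xs u v \<or> before ys u v \<or> u \<in> set xs \<and> v \<in> set ys"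
  by (induction xs) (auto simp: before_Cons)

lemma before_map:
  "before (map f xs) u v \<longleftrightarrow> (\<exists>u' v'. u = f u' \<and> v = f v' \<and> before xs u' v')"
  by (induction xs) (auto simp: before_Cons)

lemma set_postorder: "set (postorder T) = leaves T \<union> internal_nodes T"
  by (induction T) auto

lemma visited_before_Leaf [simp]: "\<not> visited_before Leaf u v"
  by (simp add: visited_before_eq_before before_Cons)

lemma visited_before_left [simp]:
  "visited_before (Node l r) u (False # v) \<longleftrightarrow> (\<exists>u'. u = False # u' \<and> visited_before l u' v)"
  by (auto simp: visited_before_eq_before before_append before_map before_Cons)

text \<open>The whole left subtree is visited before the right one. The assumption guarantees that
  \<open>v\<close> really occurs in \<open>postorder r\<close>.\<close>

lemma visited_before_right [simp]:
  assumes "v \<in> leaves r"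
  shows "visited_before (Node l r) u (True # v) \<longleftrightarrow>
    (\<exists>u'. u = True # u' \<and> visited_before r u' v) \<or>
    (\<exists>u'. u = False # u' \<and> u' \<in> leaves l \<union> internal_nodes l)"
  using assms
  by (auto simp: visited_before_eq_before before_append before_map before_Cons set_postorder)

section \<open>Leaves, internal nodes and the sink\<close>

lemma finite_leaves [simp]: "finite (leaves T)"
  by (induction T) auto

lemma finite_internal_nodes [simp]: "finite (internal_nodes T)"
  by (induction T) auto

lemma leaves_nonempty: "leaves T \<noteq> {}"
  by (induction T) auto

lemma leaves_disjoint_internal_nodes: "leaves T \<inter> internal_nodes T = {}"
  by (induction T) auto

lemma card_internal_nodes_Node [simp]:
  "card (internal_nodes (Node l r)) = Suc (card (internal_nodes l) + card (internal_nodes r))"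
proof -
  have "card (Cons False ` internal_nodes l \<union> Cons True ` internal_nodes r) =
      card (internal_nodes l) + card (internal_nodes r)"
    by (subst card_Un_disjoint) (auto simp: card_image)
  then show ?thesis by (simp add: image_iff)
qed

lemma card_internal_nodes_eq_0 [simp]: "card (internal_nodes T) = 0 \<longleftrightarrow> T = Leaf"
  by (cases T) auto

lemma sink_Leaf [simp]: "sink Leaf = []"
  by (simp add: sink_def)

lemma sink_Node [simp]: "sink (Node l r) = False # sink l"
proof -
  have "filter (\<lambda>v. v \<in> leaves l) (postorder l) \<noteq> []"
    using leaves_nonempty[of l] by (auto simp: filter_empty_conv set_postorder)
  moreover have "(\<lambda>v. v \<in> leaves (Node l r)) \<circ> Cons False = (\<lambda>v. v \<in> leaves l)"
    by auto
  ultimately show ?thesis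
    unfolding sink_def by (simp add: filter_map hd_append hd_map del: leaves.simps)
qed

lemma sink_in_leaves: "sink T \<in> leaves T"
  by (induction T) auto

lemma not_visited_before_sink: "\<not> visited_before T u (sink T)"
  by (induction T arbitrary: u) auto

lemma sink_visited_before: "v \<in> leaves T \<Longrightarrow> v \<noteq> sink T \<Longrightarrow> visited_before T (sink T) v"
  by (induction T arbitrary: v) (fastforce simp: sink_in_leaves)+

abbreviation internal_before :: "full_tree \<Rightarrow> pos \<Rightarrow> pos set" where
  "internal_before T v \<equiv> {u \<in> internal_nodes T. visited_before T u v}"

lemma card_internal_before_left:
  "card (internal_before (Node l r) (False # v)) = card (internal_before l v)"
proof -
  have "internal_before (Node l r) (False # v) = Cons False ` internal_before l v"
    by auto
  then show ?thesis by (simp add: card_image)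
qed

text \<open>The extra \<open>card (internal_nodes l)\<close> is the shift of the second argument in
  \<open>weight\<close> for the right subtree.\<close>

lemma card_internal_before_right:
  assumes "v \<in> leaves r"
  shows "card (internal_before (Node l r) (True # v)) =
    card (internal_nodes l) + card (internal_before r v)"
proof -
  have "internal_before (Node l r) (True # v) =
      Cons False ` internal_nodes l \<union> Cons True ` internal_before r v"
    using assms by auto
  moreover have "Cons False ` internal_nodes l \<inter> Cons True ` internal_before r v = {}"
    by auto
  then have "card (Cons False ` internal_nodes l \<union> Cons True ` internal_before r v) =
      card (internal_nodes l) + card (internal_before r v)"
    by (subst card_Un_disjoint) (simp_all add: card_image)
  ultimately show ?thesis by (simp only:)
qed

text \<open>Number of pointer assignments to all the leaves, when \<open>m\<close> further targets precede the tree.\<close>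

fun weight :: "full_tree \<Rightarrow> nat \<Rightarrow> nat" where
  "weight Leaf m = m"
| "weight (Node l r) m = weight l m * weight r (m + card (internal_nodes l))"

lemma prod_leaves_eq_weight:
  "(\<Prod>v\<in>leaves T. m + card (internal_before T v)) = weight T m"
proof (induction T arbitrary: m)
  case Leaf
  then show ?case by simp
next
  case (Node l r)
  have "(\<Prod>v\<in>leaves (Node l r). m + card (internal_before (Node l r) v)) =
      (\<Prod>v\<in>leaves l. m + card (internal_before (Node l r) (False # v))) *
      (\<Prod>v\<in>leaves r. m + card (internal_before (Node l r) (True # v)))"
    unfolding leaves.simps
    by (subst prod.union_disjoint) (auto simp: prod.reindex simp del: internal_nodes.simps)
  also have "(\<Prod>v\<in>leaves l. m + card (internal_before (Node l r) (False # v))) = weight l m"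
    by (simp only: card_internal_before_left Node.IH)
  also have "(\<Prod>v\<in>leaves r. m + card (internal_before (Node l r) (True # v))) =
      (\<Prod>v\<in>leaves r. (m + card (internal_nodes l)) + card (internal_before r v))"
    by (intro prod.cong) (simp_all only: card_internal_before_right add.assoc)
  finally show ?case by (simp only: Node.IH weight.simps)
qed

text \<open>Partial maps with domain \<open>D\<close> correspond to the extensional functions on
  \<open>D\<close>, which are counted by \<open>card_PiE\<close>.\<close>

lemma card_maps:
  assumes "finite D"
  shows "card {p. dom p = D \<and> (\<forall>v u. p v = Some u \<longrightarrow> u \<in> B v)} = (\<Prod>v\<in>D. card (B v))"
proof -
  have "bij_betw (\<lambda>f v. if v \<in> D then Some (f v) else None) (Pi\<^sub>E D B)
      {p. dom p = D \<and> (\<forall>v u. p v = Some u \<longrightarrow> u \<in> B v)}"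
  proof (rule bij_betw_byWitness[where f' = "\<lambda>p. \<lambda>v\<in>D. the (p v)"])
    show "\<forall>f\<in>Pi\<^sub>E D B. (\<lambda>v\<in>D. the (if v \<in> D then Some (f v) else None)) = f"
      by (auto simp: fun_eq_iff PiE_def extensional_def)
    show "\<forall>p\<in>{p. dom p = D \<and> (\<forall>v u. p v = Some u \<longrightarrow> u \<in> B v)}.
        (\<lambda>v. if v \<in> D then Some ((\<lambda>v\<in>D. the (p v)) v) else None) = p"
      by (auto simp: fun_eq_iff domIff)
    show "(\<lambda>f v. if v \<in> D then Some (f v) else None) ` Pi\<^sub>E D B
        \<subseteq> {p. dom p = D \<and> (\<forall>v u. p v = Some u \<longrightarrow> u \<in> B v)}"
      by (auto simp: PiE_def Pi_def dom_def split: if_splits)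
    show "(\<lambda>p. \<lambda>v\<in>D. the (p v)) ` {p. dom p = D \<and> (\<forall>v u. p v = Some u \<longrightarrow> u \<in> B v)}
        \<subseteq> Pi\<^sub>E D B"
      by (auto simp: PiE_def Pi_def)
  qed
  from bij_betw_same_card[OF this] show ?thesis
    using assms by (simp add: card_PiE)
qed

lemma card_pointer_maps: "card {p. is_relaxed_tree (T, p)} = weight T 1"
proof -
  let ?D = "leaves T - {sink T}"
  let ?B = "\<lambda>v. {u \<in> insert (sink T) (internal_nodes T). visited_before T u v}"
  have "{p. is_relaxed_tree (T, p)} = {p. dom p = ?D \<and> (\<forall>v u. p v = Some u \<longrightarrow> u \<in> ?B v)}"
    by (auto simp: is_relaxed_tree_def)
  then have "card {p. is_relaxed_tree (T, p)} = (\<Prod>v\<in>?D. card (?B v))"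
    by (simp only: card_maps finite_Diff finite_leaves)
  also have "\<dots> = (\<Prod>v\<in>?D. 1 + card (internal_before T v))"
  proof (rule prod.cong)
    fix v assume "v \<in> ?D"
    then have "?B v = insert (sink T) (internal_before T v)"
      by (auto simp: sink_visited_before)
    moreover have "sink T \<notin> internal_nodes T"
      using sink_in_leaves leaves_disjoint_internal_nodes by blast
    ultimately show "card (?B v) = 1 + card (internal_before T v)"
      by simp
  qed simp
  \<comment> \<open>No node precedes the sink, so its factor is \<open>1 + 0\<close> and including
    it changes nothing.\<close>
  also have "\<dots> = (\<Prod>v\<in>leaves T. 1 + card (internal_before T v))"
    by (simp add: prod.remove[OF finite_leaves sink_in_leaves[of T]] not_visited_before_sink)
  finally show ?thesis by (simp only: prod_leaves_eq_weight)
qed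

subsection \<open>Recurrences\<close>

text \<open>
  The strict bound makes the tree classes closed under subtrees: the right subtree of the root
  has bound \<open>k - 1\<close>, and bound \<open>0\<close> leaves only the single leaf.
\<close>

definition spine_trees :: "nat \<Rightarrow> nat \<Rightarrow> full_tree set" where
  "spine_trees k n =
     {T. card (internal_nodes T) = n \<and> (\<forall>v\<in>internal_nodes T. count_list v True < k)}"

lemma right_height_le_iff: "right_height T \<le> k \<longleftrightarrow> (\<forall>v\<in>internal_nodes T. count_list v True < Suc k)"
  by (auto simp: right_height_def less_Suc_eq_le)

lemma spine_trees_0 [simp]: "spine_trees k 0 = {Leaf}"
  by (auto simp: spine_trees_def)

lemma spine_trees_0_Suc [simp]: "spine_trees 0 (Suc n) = {}"
proof -
  have "T \<notin> spine_trees 0 (Suc n)" for T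
    by (cases T) (auto simp: spine_trees_def)
  then show ?thesis by blast
qed

text \<open>Split at the root: prefixing a position with \<open>False\<close> keeps its number of
  right edges, prefixing \<open>True\<close> adds one, so only the right subtree loses one unit of
  the bound.\<close>

lemma spine_trees_Suc_Suc:
  "spine_trees (Suc k) (Suc n) =
     (\<Union>i\<le>n. (\<lambda>(l, r). Node l r) ` (spine_trees (Suc k) i \<times> spine_trees k (n - i)))"
proof (rule set_eqI)
  fix T
  show "T \<in> spine_trees (Suc k) (Suc n) \<longleftrightarrow>
    T \<in> (\<Union>i\<le>n. (\<lambda>(l, r). Node l r) ` (spine_trees (Suc k) i \<times> spine_trees k (n - i)))"
  proof (cases T)
    case Leaf
    then show ?thesis by (auto simp: spine_trees_def)
  next
    case (Node l r)
    have "T \<in> spine_trees (Suc k) (Suc n) \<longleftrightarrow>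
        card (internal_nodes l) + card (internal_nodes r) = n \<and>
        (\<forall>v\<in>internal_nodes l. count_list v True < Suc k) \<and>
        (\<forall>v\<in>internal_nodes r. count_list v True < k)"
      unfolding Node spine_trees_def mem_Collect_eq card_internal_nodes_Node
      by (simp add: ball_Un)
    also have "\<dots> \<longleftrightarrow> (\<exists>i\<le>n. l \<in> spine_trees (Suc k) i \<and> r \<in> spine_trees k (n - i))"
      by (auto simp: spine_trees_def)
    finally show ?thesis
      unfolding Node by auto
  qed
qed

lemma finite_spine_trees [simp]: "finite (spine_trees k n)"
proof (induction n arbitrary: k rule: less_induct)
  case (less n)
  show ?case
  proof (cases n; cases k)
    fix n' k' assume "n = Suc n'" "k = Suc k'"
    then show ?thesis using less.IH by (auto simp: spine_trees_Suc_Suc less_Suc_eq_le)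
  qed (auto simp: spine_trees_0)
qed

definition total_weight :: "nat \<Rightarrow> nat \<Rightarrow> nat \<Rightarrow> nat" where
  "total_weight k n m = (\<Sum>T\<in>spine_trees k n. weight T m)"

lemma relaxed_count_eq_total_weight: "relaxed_count k n = total_weight (Suc k) n 1"
proof -
  have "relaxed_trees k n = (SIGMA T:spine_trees (Suc k) n. {p. is_relaxed_tree (T, p)})"
    by (auto simp: relaxed_trees_def spine_trees_def right_height_le_iff)
  moreover have "finite {p. is_relaxed_tree (T, p)}" for T
  proof -
    \<comment> \<open>Infinite sets have \<open>card\<close> zero, so a positive count already
      yields finiteness.\<close>
    have "weight T m > 0" if "m > 0" for m
      using that by (induction T arbitrary: m) auto
    then show ?thesis
      using card_pointer_maps[of T] card_gt_0_iff[of "{p. is_relaxed_tree (T, p)}"] by simp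
  qed
  ultimately show ?thesis
    by (simp add: relaxed_count_def total_weight_def card_pointer_maps)
qed

lemma total_weight_0 [simp]: "total_weight k 0 m = m"
  by (simp add: total_weight_def)

lemma total_weight_0_Suc [simp]: "total_weight 0 (Suc n) m = 0"
  by (simp add: total_weight_def)

lemma total_weight_Suc_Suc:
  "total_weight (Suc k) (Suc n) m =
     (\<Sum>i\<le>n. total_weight (Suc k) i m * total_weight k (n - i) (m + i))"
proof -
  let ?A = "\<lambda>i. spine_trees (Suc k) i \<times> spine_trees k (n - i)"
  \<comment> \<open>The size of the left subtree determines \<open>i\<close>, which makes the union
    disjoint; it is also the shift in \<open>weight\<close>.\<close>
  have size: "card (internal_nodes T) = i" if "T \<in> spine_trees j i" for T i j
    using that by (simp add: spine_trees_def)
  have "total_weight (Suc k) (Suc n) m =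
      (\<Sum>i\<le>n. \<Sum>T\<in>(\<lambda>(l, r). Node l r) ` ?A i. weight T m)"
    unfolding total_weight_def spine_trees_Suc_Suc
    by (intro sum.UNION_disjoint) (auto dest: size)
  also have "\<dots> = (\<Sum>i\<le>n. \<Sum>(l, r)\<in>?A i. weight l m * weight r (m + i))"
    by (intro sum.cong refl, subst sum.reindex)
      (auto simp: inj_on_def size intro!: sum.cong)
  finally show ?thesis
    by (simp add: total_weight_def sum_product sum.cartesian_product)
qed

text \<open>With bound \<open>0\<close> the right subtree must be a leaf, so only
  \<open>i = n\<close> survives, with factor \<open>m + n\<close>.\<close>

lemma total_weight_1_Suc: "total_weight 1 (Suc n) m = (m + n) * total_weight 1 n m"
proof -
  have "total_weight 1 (Suc n) m =
      (\<Sum>i\<le>n. total_weight 1 i m * (if i = n then m + n else 0))"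
    unfolding One_nat_def total_weight_Suc_Suc
  proof (intro sum.cong refl)
    fix i assume "i \<in> {..n}"
    then show "total_weight (Suc 0) i m * total_weight 0 (n - i) (m + i) =
        total_weight (Suc 0) i m * (if i = n then m + n else 0)"
      by (cases "n - i") auto
  qed
  then show ?thesis by (simp add: if_distrib cong: if_cong)
qed

text \<open>Raising \<open>n\<close> multiplies each old summand of the convolution by
  \<open>m + n\<close>, whatever \<open>i\<close> is; the new summand \<open>i = Suc n\<close>
  contributes the remaining factor \<open>m + n + 1\<close>.\<close>

lemma total_weight_2_Suc_Suc:
  "total_weight 2 (Suc (Suc n)) m = (2 * m + 2 * n + 1) * total_weight 2 (Suc n) m"
proof -
  have rec: "total_weight 2 (Suc n) m = (\<Sum>i\<le>n. total_weight 2 i m * total_weight 1 (n - i) (m + i))"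
    for n
    using total_weight_Suc_Suc[of 1 n m] by (simp add: numeral_2_eq_2)
  have "total_weight 1 (Suc n - i) (m + i) = (m + n) * total_weight 1 (n - i) (m + i)" if "i \<le> n" for i
    using that total_weight_1_Suc[of "n - i" "m + i"] by (simp add: Suc_diff_le)
  then have "(\<Sum>i\<le>n. total_weight 2 i m * total_weight 1 (Suc n - i) (m + i)) =
      (\<Sum>i\<le>n. (m + n) * (total_weight 2 i m * total_weight 1 (n - i) (m + i)))"
    by (intro sum.cong) auto
  then have "(\<Sum>i\<le>n. total_weight 2 i m * total_weight 1 (Suc n - i) (m + i)) =
      (m + n) * total_weight 2 (Suc n) m"
    by (simp only: rec sum_distrib_left)
  then show ?thesis
    by (simp add: rec[of "Suc n"] algebra_simps)
qed

text \<open>The preceding recurrence does not extend to the step from size \<open>0\<close> to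
  \<open>1\<close>, where its factor would be \<open>2 * m - 1\<close> instead of \<open>m\<close>.
  This exception is why \<open>i = n\<close> is treated separately below.\<close>

lemma total_weight_2_1: "total_weight 2 (Suc 0) m = m * m"
  using total_weight_Suc_Suc[of 1 0 m] by (simp add: numeral_2_eq_2)

text \<open>The sum \<open>U\<close> over \<open>i < n\<close> is multiplied by a factor free of
  \<open>i\<close> when \<open>n\<close> grows. Eliminating \<open>U\<close> between the expressions
  for sizes \<open>n + 1\<close> and \<open>n + 2\<close> leaves a recurrence of order two.\<close>

lemma total_weight_3_Suc_Suc:
  "total_weight 3 (Suc (Suc n)) m + (m + n) * (m + n - 1) * total_weight 3 n m =
     3 * (m + n) * total_weight 3 (Suc n) m"
proof -
  have rec: "total_weight 3 (Suc n) m = (\<Sum>i\<le>n. total_weight 3 i m * total_weight 2 (n - i) (m + i))"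
    for n
    using total_weight_Suc_Suc[of 2 n m] by (simp add: numeral_3_eq_3 numeral_2_eq_2)
  define U where "U = (\<Sum>i<n. total_weight 3 i m * total_weight 2 (n - i) (m + i))"
  have t1: "total_weight 3 (Suc n) m = (m + n) * total_weight 3 n m + U"
    by (simp add: rec U_def flip: lessThan_Suc_atMost)
  have "(\<Sum>i<n. total_weight 3 i m * total_weight 2 (Suc n - i) (m + i)) =
      (\<Sum>i<n. (2 * (m + n) - 1) * (total_weight 3 i m * total_weight 2 (n - i) (m + i)))"
  proof (intro sum.cong refl)
    fix i assume "i \<in> {..<n}"
    \<comment> \<open>For this \<open>j\<close> the factor \<open>2 * (m + i) + 2 * j + 1\<close>
      equals \<open>2 * (m + n) - 1\<close>.\<close>
    then obtain j where "n = Suc (i + j)" by (auto simp: less_iff_Suc_add)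
    then show "total_weight 3 i m * total_weight 2 (Suc n - i) (m + i) =
      (2 * (m + n) - 1) * (total_weight 3 i m * total_weight 2 (n - i) (m + i))"
      using total_weight_2_Suc_Suc[of j "m + i"] by (simp add: Suc_diff_le algebra_simps)
  qed
  then have "(\<Sum>i<n. total_weight 3 i m * total_weight 2 (Suc n - i) (m + i)) =
      (2 * (m + n) - 1) * U"
    by (simp only: U_def sum_distrib_left)
  then have t2: "total_weight 3 (Suc (Suc n)) m =
      (2 * (m + n) - 1) * U + (m + n) ^ 2 * total_weight 3 n m
        + (m + n + 1) * total_weight 3 (Suc n) m"
    by (simp add: rec[of "Suc n"] total_weight_2_1 power2_eq_square algebra_simps
        flip: lessThan_Suc_atMost)
  show ?thesis
  \<comment> \<open>Subtraction on naturals truncates at \<open>m + n = 0\<close>; there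
    \<open>U\<close> is the empty sum.\<close>
  proof (cases "m + n")
    case 0
    then show ?thesis using t1 t2 by (simp add: U_def)
  next
    case (Suc q)
    show ?thesis unfolding t2 t1 Suc by (simp add: algebra_simps power2_eq_square)
  qed
qed

section \<open>Relaxed trees of right height at most 2\<close>

lemma relaxed_count_2_0: "relaxed_count 2 0 = 1"
  by (simp add: relaxed_count_eq_total_weight)

lemma relaxed_count_2_1: "relaxed_count 2 (Suc 0) = 1"
  using total_weight_Suc_Suc[of 2 0 1] by (simp add: relaxed_count_eq_total_weight)

lemma relaxed_count_2_rec:
  "relaxed_count 2 (Suc (Suc n)) + Suc n * n * relaxed_count 2 n = 3 * Suc n * relaxed_count 2 (Suc n)"
  using total_weight_3_Suc_Suc[of n 1] by (simp add: relaxed_count_eq_total_weight)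

subsection \<open>Explicit coefficients and differential equation\<close>

text \<open>The roots of \<open>x^2 - 3 * x + 1\<close>, the characteristic polynomial of the
  recurrence after division by factorials. Being mutually inverse, they make
  \<open>smaller_root\<close> the radius of convergence.\<close>

definition larger_root :: real where "larger_root = (3 + sqrt 5) / 2"
definition smaller_root :: real where "smaller_root = (3 - sqrt 5) / 2"

lemma larger_root_power2: "larger_root ^ 2 = 3 * larger_root - 1"
  by (simp add: larger_root_def power2_eq_square field_simps)

lemma smaller_root_power2: "smaller_root ^ 2 = 3 * smaller_root - 1"
  by (simp add: smaller_root_def power2_eq_square field_simps)

lemma larger_root_mult_smaller_root: "larger_root * smaller_root = 1"
  by (simp add: larger_root_def smaller_root_def field_simps)

lemma smaller_root_pos: "0 < smaller_root"
  by (simp add: smaller_root_def real_less_lsqrt)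

lemma smaller_root_less_larger_root: "smaller_root < larger_root"
  by (simp add: smaller_root_def larger_root_def)

lemma larger_root_minus_smaller_root: "larger_root - smaller_root = sqrt 5"
  by (simp add: smaller_root_def larger_root_def field_simps)

lemma larger_root_plus_smaller_root: "larger_root + smaller_root = 3"
  by (simp add: smaller_root_def larger_root_def field_simps)

lemma relaxed_count_2_Suc:
  "real (relaxed_count 2 (Suc n)) =
     fact n / sqrt 5 * (larger_root ^ Suc n - smaller_root ^ Suc n)"
proof (induction n rule: induct_nat_012)
  case 0
  then show ?case by (simp add: relaxed_count_2_1 larger_root_minus_smaller_root)
next
  case 1
  have "relaxed_count 2 (Suc (Suc 0)) = 3"
    using relaxed_count_2_rec[of 0] by (simp add: relaxed_count_2_1)
  moreover have "larger_root ^ 2 - smaller_root ^ 2 = 3 * sqrt 5"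
    by (simp add: larger_root_power2 smaller_root_power2 flip: larger_root_minus_smaller_root)
  ultimately show ?case by (simp add: numeral_2_eq_2)
next
  case (ge2 n)
  have rec: "x ^ Suc (Suc (Suc n)) = 3 * x ^ Suc (Suc n) - x ^ Suc n" if "x ^ 2 = 3 * x - 1" for x :: real
  proof -
    have "x ^ Suc (Suc (Suc n)) = x ^ 2 * x ^ Suc n" by (simp add: power2_eq_square)
    also have "\<dots> = 3 * x ^ Suc (Suc n) - x ^ Suc n" by (simp add: that algebra_simps)
    finally show ?thesis .
  qed
  \<comment> \<open>Dividing the count of size \<open>k\<close> by \<open>fact (k - 1)\<close> gives
    \<open>d k\<close>, whose recurrence has constant coefficients.\<close>
  define d where "d k = (larger_root ^ k - smaller_root ^ k) / sqrt 5" for k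
  have d: "d (Suc (Suc (Suc n))) = 3 * d (Suc (Suc n)) - d (Suc n)"
    unfolding d_def rec[OF larger_root_power2] rec[OF smaller_root_power2]
    by (simp add: diff_divide_distrib add_divide_distrib algebra_simps del: power_Suc)
  have "real (relaxed_count 2 (Suc (Suc (Suc n))) + Suc (Suc n) * Suc n * relaxed_count 2 (Suc n)) =
      real (3 * Suc (Suc n) * relaxed_count 2 (Suc (Suc n)))"
    by (simp only: relaxed_count_2_rec)
  moreover have "real (relaxed_count 2 (Suc n)) = fact n * d (Suc n)"
    and "real (relaxed_count 2 (Suc (Suc n))) = fact (Suc n) * d (Suc (Suc n))"
    using ge2 by (simp_all add: d_def)
  ultimately have "real (relaxed_count 2 (Suc (Suc (Suc n)))) =
      3 * real (Suc (Suc n)) * (fact (Suc n) * d (Suc (Suc n)))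
        - real (Suc (Suc n)) * real (Suc n) * (fact n * d (Suc n))"
    by (simp only: of_nat_add of_nat_mult of_nat_numeral)
  also have "\<dots> = fact (Suc (Suc n)) * d (Suc (Suc (Suc n)))"
    by (simp only: d fact_Suc) (simp only: algebra_simps of_nat_mult)
  finally show ?case by (simp add: d_def)
qed

section \<open>The generating function as a formal power series\<close>

lemma fps_nth_relaxed_egf: "fps_nth (relaxed_egf k) n = of_nat (relaxed_count k n) / fact n"
  by (simp add: relaxed_egf_def)

text \<open>Coefficientwise this is the recurrence divided by a factorial. It is an integrated form
  of the second-order equation, which follows by differentiating.\<close>

lemma relaxed_egf_2_first_order:
  "(fps_X ^ 2 - 3 * fps_X + 1) * fps_deriv (relaxed_egf 2) = 1"
proof (rule fps_ext)
  fix n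
  have expand: "(fps_X ^ 2 - 3 * fps_X + 1) * F = fps_X ^ 2 * F - fps_const 3 * (fps_X * F) + F"
    for F :: "complex fps"
    by (simp add: algebra_simps numeral_fps_const)
  have deriv: "fps_nth (fps_deriv (relaxed_egf 2)) k = of_nat (relaxed_count 2 (Suc k)) / fact k" for k
    by (simp add: fps_nth_relaxed_egf del: of_nat_Suc)
  consider "n = 0" | "n = 1" | k where "n = Suc (Suc k)"
    by (metis One_nat_def not0_implies_Suc)
  then show "fps_nth ((fps_X ^ 2 - 3 * fps_X + 1) * fps_deriv (relaxed_egf 2)) n = fps_nth 1 n"
  proof cases
    case 1
    then show ?thesis
      unfolding expand by (simp add: fps_X_power_mult_nth deriv relaxed_count_2_1 del: fps_deriv_nth)
  next
    case 2
    then show ?thesis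
      unfolding expand using relaxed_count_2_rec[of 0]
      by (simp add: fps_X_power_mult_nth deriv relaxed_count_2_1 del: fps_deriv_nth)
  next
    case 3
    have "of_nat (relaxed_count 2 (Suc (Suc (Suc k))) + Suc (Suc k) * Suc k * relaxed_count 2 (Suc k)) =
        (of_nat (3 * Suc (Suc k) * relaxed_count 2 (Suc (Suc k))) :: complex)"
      by (simp only: relaxed_count_2_rec)
    then have rec: "of_nat (relaxed_count 2 (Suc (Suc (Suc k)))) =
        3 * of_nat (Suc (Suc k)) * of_nat (relaxed_count 2 (Suc (Suc k)))
        - of_nat (Suc (Suc k)) * of_nat (Suc k) * (of_nat (relaxed_count 2 (Suc k)) :: complex)"
      by (simp only: of_nat_add of_nat_mult of_nat_numeral) (simp add: eq_diff_eq)
    have "fps_nth ((fps_X ^ 2 - 3 * fps_X + 1) * fps_deriv (relaxed_egf 2)) n =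
        of_nat (relaxed_count 2 (Suc k)) / fact k
        - 3 * (of_nat (relaxed_count 2 (Suc (Suc k))) / fact (Suc k))
        + of_nat (relaxed_count 2 (Suc (Suc (Suc k)))) / fact (Suc (Suc k))"
      unfolding expand 3 by (simp add: fps_X_power_mult_nth deriv del: fps_deriv_nth fact_Suc)
    also have "\<dots> = 0"
    proof -
      \<comment> \<open>Here \<open>f\<close>, \<open>s * f\<close> and \<open>t * (s * f)\<close>
        stand for the three consecutive factorials, and the last numerator is the recurrence solved
        for its highest term.\<close>
      have "x / f - 3 * (y / (s * f)) + (3 * t * y - t * s * x) / (t * (s * f)) = 0"
        if "s \<noteq> 0" "t \<noteq> 0" "f \<noteq> 0" for x y s t f :: complex
        using that by (simp add: field_simps)
      from this[of "of_nat (Suc k)" "of_nat (Suc (Suc k))" "fact k"] show ?thesis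
        unfolding rec fact_Suc by (simp del: of_nat_Suc)
    qed
    finally show ?thesis by (simp add: 3)
  qed
qed

lemma relaxed_egf_2_second_order:
  "(fps_X ^ 2 - 3 * fps_X + 1) * fps_deriv (fps_deriv (relaxed_egf 2))
     + (2 * fps_X - 3) * fps_deriv (relaxed_egf 2) = 0"
proof -
  have "fps_deriv (fps_X ^ 2 - 3 * fps_X + 1 :: complex fps) = 2 * fps_X - 3"
    by (simp add: fps_deriv_power numeral_fps_const)
  then show ?thesis
    using arg_cong[OF relaxed_egf_2_first_order, of fps_deriv] by (simp add: add.commute mult.commute)
qed

lemma D_finite_relaxed_egf_2: "D_finite (relaxed_egf 2)"
proof -
  define a :: "nat \<Rightarrow> complex poly"
    where "a i = (if i = 2 then [:1, -3, 1:] else if i = 1 then [:-3, 2:] else 0)" for i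
  have a: "fps_of_poly (a 2) = fps_X ^ 2 - 3 * fps_X + 1" "fps_of_poly (a 1) = 2 * fps_X - 3"
    "fps_of_poly (a 0) = 0"
    by (simp_all add: a_def fps_of_poly_pCons numeral_fps_const algebra_simps power2_eq_square
        flip: fps_const_neg)
  have sum: "(\<Sum>i\<le>2. g i) = g 0 + g 1 + g 2" for g :: "nat \<Rightarrow> complex fps"
    by (simp add: numeral_2_eq_2)
  have "(fps_deriv ^^ 2) F = fps_deriv (fps_deriv F)" for F :: "complex fps"
    by (simp add: numeral_2_eq_2)
  then have "(\<Sum>i\<le>2. fps_of_poly (a i) * (fps_deriv ^^ i) (relaxed_egf 2)) = 0"
    unfolding sum a using relaxed_egf_2_second_order by (simp add: add.commute)
  moreover have "a 2 \<noteq> 0" by (simp add: a_def)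
  ultimately show ?thesis unfolding D_finite_def by blast
qed

subsection \<open>Closed form\<close>

lemma norm_larger_root_mult_less_1:
  fixes z :: complex
  assumes "z \<in> ball 0 smaller_root"
  shows "norm (of_real larger_root * z) < 1"
proof -
  have "larger_root * norm z < larger_root * smaller_root"
    using assms smaller_root_pos smaller_root_less_larger_root by (intro mult_strict_left_mono) auto
  then show ?thesis
    using smaller_root_pos smaller_root_less_larger_root
    by (simp add: norm_mult larger_root_mult_smaller_root)
qed

lemma norm_smaller_root_mult_less_1:
  fixes z :: complex
  assumes "z \<in> ball 0 smaller_root"
  shows "norm (of_real smaller_root * z) < 1"
proof -
  have "norm (of_real smaller_root * z) \<le> norm (of_real larger_root * z)"
    using smaller_root_pos smaller_root_less_larger_root
    by (simp add: norm_mult mult_right_mono)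
  then show ?thesis
    using norm_larger_root_mult_less_1[OF assms] by linarith
qed

text \<open>Keeps the arguments of both logarithms in the right half-plane, away from the branch cut
  of \<open>Ln\<close>.\<close>

lemma Re_one_minus_pos: "norm w < 1 \<Longrightarrow> 0 < Re (1 - w)"
  using complex_Re_le_cmod[of w] by simp

text \<open>
  This is \<open>ln ((1 + w) / (1 - w)) / 2\<close> for
  \<open>w = (2 z - 3) / sqrt 5\<close>, where \<open>(1 + w) / (1 - w)\<close> equals
  \<open>- larger_root\<^sup>-\<^sup>2 (1 - larger_root z) / (1 - smaller_root z)\<close>. Splitting the logarithm in this
  way makes it holomorphic across the real axis.
\<close>

definition artanh_branch :: "complex \<Rightarrow> complex" where
  "artanh_branch z =
     (of_real pi * \<i> - 2 * of_real (ln larger_root)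
        + Ln (1 - of_real larger_root * z) - Ln (1 - of_real smaller_root * z)) / 2"

lemma artanh_branch_holomorphic: "artanh_branch holomorphic_on ball 0 smaller_root"
proof -
  have "1 - of_real larger_root * z \<notin> \<real>\<^sub>\<le>\<^sub>0" "1 - of_real smaller_root * z \<notin> \<real>\<^sub>\<le>\<^sub>0"
    if "z \<in> ball 0 smaller_root" for z :: complex
    using Re_one_minus_pos[OF norm_larger_root_mult_less_1[OF that]]
      Re_one_minus_pos[OF norm_smaller_root_mult_less_1[OF that]]
    by (auto simp: complex_nonpos_Reals_iff)
  then show ?thesis
    unfolding artanh_branch_def by (intro holomorphic_intros) auto
qed

text \<open>The equation \<open>tanh y = w\<close> solved for \<open>exp (2 * y)\<close>. It yields
  both the inversion of \<open>tanh\<close> and the comparison with the principal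
  \<open>artanh\<close>.\<close>

lemma exp_two_artanh_branch:
  assumes "z \<in> ball 0 smaller_root"
  defines "w \<equiv> (2 * z - 3) / of_real (sqrt 5)"
  shows "1 - w \<noteq> 0" "exp (2 * artanh_branch z) = (1 + w) / (1 - w)"
proof -
  define a where "a = complex_of_real larger_root"
  define b where "b = complex_of_real smaller_root"
  have ab: "a * b = 1" "a + b = 3" "a - b = of_real (sqrt 5)"
    unfolding a_def b_def
    by (simp_all only: larger_root_mult_smaller_root larger_root_plus_smaller_root
        larger_root_minus_smaller_root of_real_1 of_real_numeral flip: of_real_mult of_real_add of_real_diff)
  have nz: "1 - a * z \<noteq> 0" "1 - b * z \<noteq> 0"
    using norm_larger_root_mult_less_1[OF assms(1)] norm_smaller_root_mult_less_1[OF assms(1)]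
    by (auto simp: a_def b_def)
  have anz: "a \<noteq> 0" using ab(1) by auto
  have s: "complex_of_real (sqrt 5) \<noteq> 0" by simp
  have "1 + w = (of_real (sqrt 5) + 2 * z - 3) / of_real (sqrt 5)"
    using s by (simp add: w_def field_simps)
  \<comment> \<open>Inserting \<open>3 = a + b\<close> and \<open>sqrt 5 = a - b\<close> leaves
    \<open>2 * z - 2 * b\<close>; then \<open>a * b = 1\<close> produces the factor
    \<open>1 - a * z\<close>.\<close>
  also have "of_real (sqrt 5) + 2 * z - 3 = - 2 * b * (1 - a * z)"
    using ab by (simp add: algebra_simps flip: ab(2,3))
  finally have plus: "1 + w = - 2 * b * (1 - a * z) / of_real (sqrt 5)" .
  have "1 - w = (of_real (sqrt 5) - 2 * z + 3) / of_real (sqrt 5)"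
    using s by (simp add: w_def field_simps)
  also have "of_real (sqrt 5) - 2 * z + 3 = 2 * a * (1 - b * z)"
    using ab by (simp add: algebra_simps flip: ab(2,3))
  finally have minus: "1 - w = 2 * a * (1 - b * z) / of_real (sqrt 5)" .
  show "1 - w \<noteq> 0"
    using anz nz s by (simp add: minus)
  have "exp (2 * of_real (ln larger_root)) = a ^ 2"
    using smaller_root_pos smaller_root_less_larger_root
    by (simp add: a_def exp_double exp_of_real)
  moreover have "2 * artanh_branch z = of_real pi * \<i> - 2 * of_real (ln larger_root) + Ln (1 - a * z) - Ln (1 - b * z)"
    by (simp add: artanh_branch_def a_def b_def)
  ultimately have "exp (2 * artanh_branch z) = - 1 / a ^ 2 * (1 - a * z) / (1 - b * z)"
    using nz by (simp only: exp_add exp_diff exp_Ln exp_pi_i not_False_eq_True)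
  also have "\<dots> = - (b * (1 - a * z)) / (a * (1 - b * z))"
  proof -
    have "1 / a = b" using ab(1) anz by (simp add: field_simps)
    then show ?thesis by (simp add: power2_eq_square flip: \<open>1 / a = b\<close>)
  qed
  also have "\<dots> = (1 + w) / (1 - w)"
    using s by (simp add: plus minus)
  finally show "exp (2 * artanh_branch z) = (1 + w) / (1 - w)" .
qed

lemma tanh_artanh_branch:
  assumes "z \<in> ball 0 smaller_root"
  shows "tanh (artanh_branch z) = (2 * z - 3) / of_real (sqrt 5)"
proof -
  define w where "w = (2 * z - 3) / complex_of_real (sqrt 5)"
  define e where "e = exp (artanh_branch z)"
  have w: "1 - w \<noteq> 0" "e ^ 2 = (1 + w) / (1 - w)"
    using exp_two_artanh_branch[OF assms] by (simp_all add: w_def e_def exp_double)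
  have "e \<noteq> 0" by (simp add: e_def)
  have "tanh (artanh_branch z) = (e - 1 / e) / (e + 1 / e)"
    by (simp add: tanh_altdef e_def exp_minus field_simps)
  also have "\<dots> = (e ^ 2 - 1) / (e ^ 2 + 1)"
    using \<open>e \<noteq> 0\<close> by (simp add: power2_eq_square divide_simps)
  also have "e ^ 2 - 1 = 2 * w / (1 - w)"
    using w by (simp add: field_simps)
  also have "e ^ 2 + 1 = 2 / (1 - w)"
    using w by (simp add: field_simps)
  finally show ?thesis using w(1) unfolding w_def[symmetric] by simp
qed

lemma artanh_branch_eq_artanh:
  assumes "z \<in> ball 0 smaller_root" "Im z \<ge> 0"
  shows "artanh_branch z = artanh ((2 * z - 3) / of_real (sqrt 5))"
proof -
  define w where "w = (2 * z - 3) / complex_of_real (sqrt 5)"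
  define t where "t = Im (2 * artanh_branch z)"
  note exp_eq = exp_two_artanh_branch[OF assms(1), folded w_def]
  \<comment> \<open>The two arguments differ by less than \<open>pi\<close>, and the summand
    \<open>pi * \<i>\<close> of the branch moves this difference into
    \<open>(0, 2 * pi)\<close>.\<close>
  have "\<bar>Im (Ln (1 - of_real larger_root * z))\<bar> < pi / 2" "\<bar>Im (Ln (1 - of_real smaller_root * z))\<bar> < pi / 2"
    using Re_one_minus_pos[OF norm_larger_root_mult_less_1[OF assms(1)]]
      Re_one_minus_pos[OF norm_smaller_root_mult_less_1[OF assms(1)]]
    by (subst Re_Ln_pos_lt; force)+
  then have t: "0 < t" "t < 2 * pi"
    by (simp_all add: t_def artanh_branch_def)
  \<comment> \<open>The closed upper half-plane is preserved by the affine map to \<open>w\<close>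
    and by \<open>(1 + w) / (1 - w)\<close>.\<close>
  have "Im w \<ge> 0"
    using assms(2) by (simp add: w_def Im_divide_of_real)
  moreover have "Im ((1 + w) / (1 - w)) = 2 * Im w / (norm (1 - w)) ^ 2"
    unfolding cmod_power2 by (simp add: Im_divide algebra_simps)
  ultimately have "0 \<le> exp (Re (2 * artanh_branch z)) * sin t"
    unfolding t_def Im_exp[symmetric] exp_eq(2) by simp
  then have "sin t \<ge> 0" by (simp add: zero_le_mult_iff)
  \<comment> \<open>A priori \<open>t\<close> lies in \<open>(0, 2 pi)\<close>; the sign of the sine puts it in the range of the principal logarithm.\<close>
  with t have "t \<le> pi"
    using sin_lt_zero[of t] by linarith
  then have "Ln (exp (2 * artanh_branch z)) = 2 * artanh_branch z"
    using t pi_gt_zero by (intro Ln_exp) (simp_all only: t_def)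
  then show ?thesis
    unfolding w_def[symmetric] by (simp add: artanh_def exp_eq(2))
qed

lemma ln_eq_two_ln_larger_root: "ln ((7 + 3 * sqrt 5) / 2) = 2 * ln larger_root"
proof -
  have "(7 + 3 * sqrt 5) / 2 = larger_root ^ 2"
    unfolding larger_root_power2 by (simp add: larger_root_def field_simps)
  then show ?thesis
    using smaller_root_pos smaller_root_less_larger_root by (simp add: ln_realpow)
qed

text \<open>The coefficients for \<open>n \<ge> 1\<close> are differences of powers of the two roots
  over \<open>n * sqrt 5\<close>, so the series is a difference of two logarithm series. The
  constants in \<open>artanh_branch\<close> cancel those of the closed form.\<close>

lemma relaxed_egf_2_sums:
  assumes "z \<in> ball 0 smaller_root"
  shows "(\<lambda>n. fps_nth (relaxed_egf 2) n * z ^ n) sums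
    (1 - 2 / of_real (sqrt 5) * artanh_branch z
       - 1 / of_real (sqrt 5) * (of_real (ln ((7 + 3 * sqrt 5) / 2)) - of_real pi * \<i>))"
proof -
  define L where "L c = Ln (1 - complex_of_real c * z)" for c
  have series: "(\<lambda>n. - ((of_real c * z) ^ n) / of_nat n) sums L c"
    if "norm (of_real c * z) < 1" for c
    using Ln_series'[of "- (of_real c * z)"] that by (simp add: L_def)
  \<comment> \<open>At \<open>n = 0\<close> the logarithm series contribute \<open>0\<close> because
    division by zero gives \<open>0\<close>; the constant coefficient \<open>1\<close> is added
    explicitly.\<close>
  have "(\<lambda>n. (if n = 0 then 1 else 0) +
      1 / of_real (sqrt 5) * (- ((of_real smaller_root * z) ^ n) / of_nat n - - ((of_real larger_root * z) ^ n) / of_nat n))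
      sums (1 + 1 / of_real (sqrt 5) * (L smaller_root - L larger_root))"
    by (intro sums_add sums_mult sums_diff sums_single[of 0 "\<lambda>_. 1"] series
        norm_larger_root_mult_less_1 norm_smaller_root_mult_less_1 assms)
  also have "(\<lambda>n. (if n = 0 then 1 else 0) +
      1 / of_real (sqrt 5) * (- ((of_real smaller_root * z) ^ n) / of_nat n - - ((of_real larger_root * z) ^ n) / of_nat n)) =
      (\<lambda>n. fps_nth (relaxed_egf 2) n * z ^ n)"
  proof
    fix n
    show "(if n = 0 then 1 else 0) +
      1 / of_real (sqrt 5) * (- ((of_real smaller_root * z) ^ n) / of_nat n - - ((of_real larger_root * z) ^ n) / of_nat n)
      = fps_nth (relaxed_egf 2) n * z ^ n"
    proof (cases n)
      case 0
      then show ?thesis by (simp add: fps_nth_relaxed_egf relaxed_count_2_0)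
    next
      case (Suc k)
      have "complex_of_nat (relaxed_count 2 n) = of_real (real (relaxed_count 2 n))"
        by simp
      also have "\<dots> = fact k / of_real (sqrt 5) * (of_real larger_root ^ n - of_real smaller_root ^ n)"
        unfolding Suc relaxed_count_2_Suc by simp
      finally have nth: "fps_nth (relaxed_egf 2) n =
          1 / of_real (sqrt 5) * (of_real larger_root ^ n - of_real smaller_root ^ n) / of_nat n"
        by (simp add: fps_nth_relaxed_egf Suc del: of_nat_Suc power_Suc)
      show ?thesis
        unfolding nth using Suc by (simp add: power_mult_distrib field_simps del: of_nat_Suc power_Suc)
    qed
  qed
  also have "1 + 1 / of_real (sqrt 5) * (L smaller_root - L larger_root) =
    1 - 2 / of_real (sqrt 5) * artanh_branch z
       - 1 / of_real (sqrt 5) * (of_real (ln ((7 + 3 * sqrt 5) / 2)) - of_real pi * \<i>)"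
    by (simp add: ln_eq_two_ln_larger_root artanh_branch_def L_def field_simps)
  finally show ?thesis .
qed

theorem mainTheorem9:
  fixes R :: "complex fps"
  defines "R \<equiv> relaxed_egf 2"
  shows "(D_finite R) \<and>
    ((fps_X ^ 2 - 3 * fps_X + 1) * fps_deriv (fps_deriv R) + (2 * fps_X - 3) * fps_deriv R = 0) \<and>
    (fps_nth R 0 = 1) \<and>
    (fps_nth (fps_deriv R) 0 = 1) \<and>
    (\<exists>A :: complex \<Rightarrow> complex.
           A holomorphic_on ball 0 ((3 - sqrt 5) / 2) \<and>
           (\<forall>z \<in> ball 0 ((3 - sqrt 5) / 2). tanh (A z) = (2 * z - 3) / of_real (sqrt 5)) \<and>
           (\<forall>z \<in> ball 0 ((3 - sqrt 5) / 2). Im z \<ge> 0 \<longrightarrow>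
              A z = artanh ((2 * z - 3) / of_real (sqrt 5))) \<and>
           (\<forall>z \<in> ball 0 ((3 - sqrt 5) / 2).
              (\<lambda>n. fps_nth R n * z ^ n) sums
                (1 - 2 / of_real (sqrt 5) * A z
                   - 1 / of_real (sqrt 5) * (of_real (ln ((7 + 3 * sqrt 5) / 2)) - of_real pi * \<i>)))) \<and>
    (\<forall>n \<ge> 1. real (relaxed_count 2 n) =
           fact (n - 1) / sqrt 5 * (((3 + sqrt 5) / 2) ^ n - ((3 - sqrt 5) / 2) ^ n))"
proof -
  have count: "\<forall>n \<ge> 1. real (relaxed_count 2 n) =
      fact (n - 1) / sqrt 5 * (larger_root ^ n - smaller_root ^ n)"
  proof (intro allI impI)
    fix n :: nat
    assume "n \<ge> 1"
    then show "real (relaxed_count 2 n) =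
        fact (n - 1) / sqrt 5 * (larger_root ^ n - smaller_root ^ n)"
      using relaxed_count_2_Suc[of "n - 1"] by simp
  qed
  have nth: "fps_nth R 0 = 1" "fps_nth (fps_deriv R) 0 = 1"
    by (simp_all add: R_def fps_nth_relaxed_egf relaxed_count_2_0 relaxed_count_2_1)
  \<comment> \<open>Folding the two roots makes the goal match the lemmas; the witness for
    \<open>A\<close> is \<open>artanh_branch\<close>.\<close>
  show ?thesis
    unfolding smaller_root_def[symmetric] larger_root_def[symmetric]
    using D_finite_relaxed_egf_2 relaxed_egf_2_second_order nth count artanh_branch_holomorphic
      tanh_artanh_branch artanh_branch_eq_artanh relaxed_egf_2_sums
    unfolding R_def by blast
qed

end
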